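(* There exist a compactly supported continuous piecewise-linear seed $g:\mathbb R\to\mathbb R$ and a bounded sequence of scalar masks $a^{[k]}=(a_0^{[k]},a_1^{[k]})\in\mathbb R^2$, $k\ge1$ (supported in $\{0,1\}$), such that, with $(V_kf)(x)=a_0^{[k]}f(2x)+a_1^{[k]}f(2x-1)$ and $F_n=V_1V_2\cdots V_ng$, for every $n\ge1$ the function $F_n$ has at least $2^n$ maximal affine pieces. Hence every ReLU network of width $W$ and depth $L$ that represents $F_n$ exactly satisfies $$(W+1)^L\ge2^n,\qquad L\ge\frac{n\log2}{\log(W+1)}.$$ Thus exact realization of $F_n$ at fixed width requires depth $L=\Omega(n)$ and $\Omega(n)$ parameters.
   Context: In $V_1V_2\cdots V_ng$ the rightmost operator acts first. A ReLU network (here one-input, one-output) consists of affine maps separated by coordinatewise activations $t\mapsto\max\{t,0\}$, with an affine output layer. Width is the largest hidden dimension, depth is the number of hidden (ReLU) layers, and the parameter count includes all entries of all affine maps, including zeros. *)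

theory Defs
  imports "HOL-Analysis.Analysis" "Jordan_Normal_Form.Matrix"
begin

definition affine_fun_on :: "(real \<Rightarrow> real) \<Rightarrow> real set \<Rightarrow> bool" where
  "affine_fun_on f I \<longleftrightarrow> (\<exists>m b. \<forall>x\<in>I. f x = m * x + b)"

definition piecewise_linear :: "(real \<Rightarrow> real) \<Rightarrow> bool" where
  "piecewise_linear f \<longleftrightarrow>
     (\<exists>\<P>. finite \<P> \<and> \<Union>\<P> = UNIV \<and> (\<forall>I\<in>\<P>. is_interval I \<and> affine_fun_on f I))"

definition compactly_supported :: "(real \<Rightarrow> real) \<Rightarrow> bool" where
  "compactly_supported f \<longleftrightarrow> compact (closure {x. f x \<noteq> 0})"

text \<open>Pieces are intervals of the whole real line; for a compactly supported function the two
  unbounded pieces count as well.\<close>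

definition maximal_affine_pieces :: "(real \<Rightarrow> real) \<Rightarrow> real set set" where
  "maximal_affine_pieces f =
     {I. is_interval I \<and> interior I \<noteq> {} \<and> affine_fun_on f I \<and>
         (\<forall>J. is_interval J \<and> I \<subseteq> J \<and> affine_fun_on f J \<longrightarrow> J = I)}"

definition mask_operator :: "real \<times> real \<Rightarrow> (real \<Rightarrow> real) \<Rightarrow> real \<Rightarrow> real" where
  "mask_operator m f = (\<lambda>x. fst m * f (2 * x) + snd m * f (2 * x - 1))"

text \<open>The composition \<open>V\<^sub>1 (V\<^sub>2 (\<dots> (V\<^sub>n g)))\<close>; the value \<open>a 0\<close> is irrelevant.\<close>

definition cascade :: "(nat \<Rightarrow> real \<times> real) \<Rightarrow> (real \<Rightarrow> real) \<Rightarrow> nat \<Rightarrow> real \<Rightarrow> real" where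
  "cascade a g n = foldr (\<lambda>k. mask_operator (a k)) [1..<Suc n] g"

text \<open>A pair \<open>(A, b)\<close> stands for the affine map \<open>v \<mapsto> A v + b\<close>.\<close>

type_synonym affine_layer = "real mat \<times> real Matrix.vec"

datatype relu_net = ReLU_Net (hidden_layers: "affine_layer list") (output_layer: affine_layer)

definition all_layers :: "relu_net \<Rightarrow> affine_layer list" where
  "all_layers N = hidden_layers N @ [output_layer N]"

text \<open>The layers compose to a map from dimension \<open>d\<close> to dimension \<open>e\<close>.\<close>

fun layers_fit :: "nat \<Rightarrow> affine_layer list \<Rightarrow> nat \<Rightarrow> bool" where
  "layers_fit d [] e \<longleftrightarrow> d = e"
| "layers_fit d ((A, b) # ls) e \<longleftrightarrow>
     dim_col A = d \<and> dim_vec b = dim_row A \<and> layers_fit (dim_row A) ls e"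

definition valid_net :: "relu_net \<Rightarrow> bool" where
  "valid_net N \<longleftrightarrow> layers_fit 1 (all_layers N) 1"

fun apply_layer :: "affine_layer \<Rightarrow> real Matrix.vec \<Rightarrow> real Matrix.vec" where
  "apply_layer (A, b) v = A *\<^sub>v v + b"

definition relu_vec :: "real Matrix.vec \<Rightarrow> real Matrix.vec" where
  "relu_vec v = map_vec (\<lambda>t. max t 0) v"

definition net_fun :: "relu_net \<Rightarrow> real \<Rightarrow> real" where
  "net_fun N x =
     vec_index
       (apply_layer (output_layer N)
         (fold (\<lambda>l v. relu_vec (apply_layer l v)) (hidden_layers N) (vec_of_list [x]))) 0"

definition represents :: "relu_net \<Rightarrow> (real \<Rightarrow> real) \<Rightarrow> bool" where
  "represents N f \<longleftrightarrow> valid_net N \<and> (\<forall>x. net_fun N x = f x)"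

text \<open>Without hidden layers the width is \<open>0\<close>.\<close>

definition net_width :: "relu_net \<Rightarrow> nat" where
  "net_width N = Max (insert 0 ((\<lambda>(A, b). dim_row A) ` set (hidden_layers N)))"

definition net_depth :: "relu_net \<Rightarrow> nat" where
  "net_depth N = length (hidden_layers N)"

definition param_count :: "relu_net \<Rightarrow> nat" where
  "param_count N = (\<Sum>(A, b)\<leftarrow>all_layers N. dim_row A * dim_col A + dim_vec b)"

end

theory Submission
  imports Defs
begin

text \<open>Take the tent \<open>g\<close> on \<open>[0, 1]\<close> and all masks equal to \<open>(1, 1)\<close>: then \<open>F\<^sub>n\<close> consists of
  \<open>2\<^sup>n\<close> disjoint rescaled tents, whose rising flanks lie in distinct maximal pieces. Conversely, the
  maximal pieces inject into every finite cover of the line by intervals on which the function is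
  affine, because two affine intervals sharing two points merge. A hidden layer with \<open>w\<close> neurons
  splits each interval of such a cover into at most \<open>w + 1\<close>, so a network with hidden dimensions
  \<open>w\<^sub>1, \<dots>, w\<^sub>L\<close> has a cover of size \<open>\<Prod>(w\<^sub>i + 1)\<close>. This product is at most \<open>(W + 1)\<^sup>L\<close>, and it is at
  most \<open>2\<close> to the power \<open>\<Sum>w\<^sub>i\<close>, which bounds the parameter count from below even when some layer is
  empty.\<close>

section \<open>Affine functions on intervals\<close>

lemma affine_fun_on_subset:
  "affine_fun_on f I \<Longrightarrow> J \<subseteq> I \<Longrightarrow> affine_fun_on f J"
  unfolding affine_fun_on_def by blast

lemma affine_fun_on_const: "affine_fun_on (\<lambda>x. c) I"
  unfolding affine_fun_on_def by (rule exI[of _ 0]) auto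

lemma affine_fun_on_add:
  assumes "affine_fun_on f I" "affine_fun_on h I"
  shows "affine_fun_on (\<lambda>x. f x + h x) I"
proof -
  obtain m b m' b' where "\<forall>x\<in>I. f x = m * x + b" "\<forall>x\<in>I. h x = m' * x + b'"
    using assms unfolding affine_fun_on_def by blast
  then show ?thesis
    unfolding affine_fun_on_def
    by (intro exI[of _ "m + m'"] exI[of _ "b + b'"]) (auto simp: algebra_simps)
qed

lemma affine_fun_on_cmult:
  assumes "affine_fun_on f I"
  shows "affine_fun_on (\<lambda>x. c * f x) I"
proof -
  obtain m b where "\<forall>x\<in>I. f x = m * x + b"
    using assms unfolding affine_fun_on_def by blast
  then show ?thesis
    unfolding affine_fun_on_def
    by (intro exI[of _ "c * m"] exI[of _ "c * b"]) (auto simp: algebra_simps)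
qed

lemma affine_fun_on_sum:
  assumes "\<And>i. i \<in> A \<Longrightarrow> affine_fun_on (f i) I"
  shows "affine_fun_on (\<lambda>x. \<Sum>i\<in>A. f i x) I"
  using assms
  by (induction A rule: infinite_finite_induct)
     (auto intro: affine_fun_on_add affine_fun_on_const)

lemma affine_fun_on_compose_affine:
  assumes "affine_fun_on f I"
  shows "affine_fun_on (\<lambda>x. f (c * x + d)) ((\<lambda>x. c * x + d) -` I)"
proof -
  obtain m b where "\<forall>x\<in>I. f x = m * x + b"
    using assms unfolding affine_fun_on_def by blast
  then show ?thesis
    unfolding affine_fun_on_def
    by (intro exI[of _ "m * c"] exI[of _ "m * d + b"]) (auto simp: algebra_simps)
qed

lemma affine_coeffs_unique:
  fixes x y :: real
  assumes "x \<noteq> y" "m * x + b = m' * x + b'" "m * y + b = m' * y + b'"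
  shows "m = m' \<and> b = b'"
proof -
  have "(m - m') * (x - y) = 0" using assms by (simp add: algebra_simps)
  then show ?thesis using assms by auto
qed

text \<open>Two distinct common points determine slope and intercept, so the formulas on
  \<open>I\<close> and \<open>J\<close> coincide.\<close>

lemma affine_fun_on_Un:
  assumes "affine_fun_on f I" "affine_fun_on f J"
    and "x \<in> I \<inter> J" "y \<in> I \<inter> J" "x \<noteq> y"
  shows "affine_fun_on f (I \<union> J)"
proof -
  obtain m b m' b' where I: "\<forall>x\<in>I. f x = m * x + b" and J: "\<forall>x\<in>J. f x = m' * x + b'"
    using assms(1,2) unfolding affine_fun_on_def by blast
  have "m = m' \<and> b = b'"
    using I J assms(3,4) by (intro affine_coeffs_unique[OF assms(5)]) (metis IntD1 IntD2)+
  then show ?thesis using I J unfolding affine_fun_on_def by blast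
qed

lemma is_interval_Un:
  fixes I J :: "real set"
  assumes "is_interval I" "is_interval J" "I \<inter> J \<noteq> {}"
  shows "is_interval (I \<union> J)"
  using assms connected_Un unfolding is_interval_connected_1 by blast

text \<open>Real intervals are the convex sets, and the map is a scaling followed by a translation.
  Preimages of convex sets under linear maps are convex, which treats \<open>c = 0\<close> without a
  case distinction.\<close>

lemma is_interval_affine_vimage:
  fixes I :: "real set"
  assumes "is_interval I"
  shows "is_interval ((\<lambda>x. c * x + d) -` I)"
proof -
  have "convex ((\<lambda>x. c * x) -` ((\<lambda>x. x + d) -` I))"
  proof (rule convex_linear_vimage)
    show "linear (\<lambda>x. c * x)" by (rule linear_times)
    have "(\<lambda>x. x + d) -` I = (\<lambda>x. x - d) ` I"
      by (force simp: image_iff)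
    then show "convex ((\<lambda>x. x + d) -` I)"
      using assms by (simp add: is_interval_convex_1 convex_translation_subtract)
  qed
  moreover have "(\<lambda>x. c * x) -` ((\<lambda>x. x + d) -` I) = (\<lambda>x. c * x + d) -` I" by auto
  ultimately show ?thesis by (simp add: is_interval_convex_1)
qed

lemma affine_on_infinite_merge:
  fixes I J :: "real set"
  assumes "is_interval I" "is_interval J" "affine_fun_on f I" "affine_fun_on f J"
    and "infinite (I \<inter> J)"
  shows "is_interval (I \<union> J)" "affine_fun_on f (I \<union> J)"
proof -
  obtain x where x: "x \<in> I \<inter> J"
    using infinite_imp_nonempty[OF assms(5)] by blast
  have "infinite (I \<inter> J - {x})" using assms(5) by simp
  then obtain y where y: "y \<in> I \<inter> J" "x \<noteq> y"
    using infinite_imp_nonempty by blast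
  show "is_interval (I \<union> J)" using is_interval_Un assms x by blast
  show "affine_fun_on f (I \<union> J)" using affine_fun_on_Un assms x y by blast
qed

section \<open>Maximal pieces and interval covers\<close>

lemma infinite_if_interior_nonempty:
  fixes I :: "real set"
  assumes "interior I \<noteq> {}"
  shows "infinite I"
proof
  assume "finite I"
  then have "finite (interior I)" using interior_subset finite_subset by blast
  then show False using assms open_interior finite_imp_not_open by blast
qed

text \<open>The piece is the union of all affine intervals containing \<open>I\<close>. They share a
  point of \<open>I\<close>, so the union is connected. They share two points of \<open>I\<close>,
  so all of them follow the affine formula of \<open>I\<close>.\<close>

lemma maximal_affine_piece_exists:
  assumes "is_interval I" "interior I \<noteq> {}" "affine_fun_on f I"
  shows "\<exists>M\<in>maximal_affine_pieces f. I \<subseteq> M"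
proof -
  define \<J> where "\<J> = {J. is_interval J \<and> I \<subseteq> J \<and> affine_fun_on f J}"
  have "infinite I" by (rule infinite_if_interior_nonempty[OF assms(2)])
  obtain x where x: "x \<in> I" using infinite_imp_nonempty[OF \<open>infinite I\<close>] by blast
  have "infinite (I - {x})" using \<open>infinite I\<close> by simp
  then obtain y where y: "y \<in> I" "x \<noteq> y" using infinite_imp_nonempty by blast
  obtain m b where mb: "\<forall>x\<in>I. f x = m * x + b"
    using assms(3) unfolding affine_fun_on_def by blast
  have affJ: "f z = m * z + b" if z: "J \<in> \<J>" "z \<in> J" for J z
  proof -
    obtain m' b' where J: "\<forall>x\<in>J. f x = m' * x + b'"
      using z(1) unfolding \<J>_def affine_fun_on_def by blast
    have "I \<subseteq> J" using z by (auto simp: \<J>_def)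
    then have "m = m' \<and> b = b'"
      using mb J x y by (intro affine_coeffs_unique[OF y(2)]) (metis subsetD)+
    then show ?thesis using J z by simp
  qed
  have IJ: "I \<in> \<J>" using assms by (simp add: \<J>_def)
  have "connected (\<Union>\<J>)"
    by (rule connected_Union) (use x in \<open>auto simp: \<J>_def is_interval_connected_1\<close>)
  then have int: "is_interval (\<Union>\<J>)" by (simp add: is_interval_connected_1)
  have aff: "affine_fun_on f (\<Union>\<J>)"
    unfolding affine_fun_on_def using affJ by blast
  have sub: "I \<subseteq> \<Union>\<J>" using IJ by blast
  have "interior (\<Union>\<J>) \<noteq> {}" using interior_mono[OF sub] assms(2) by blast
  moreover have "J = \<Union>\<J>" if "is_interval J" "\<Union>\<J> \<subseteq> J" "affine_fun_on f J" for J
    using that sub unfolding \<J>_def by blast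
  ultimately have "\<Union>\<J> \<in> maximal_affine_pieces f"
    unfolding maximal_affine_pieces_def using int aff by blast
  then show ?thesis using sub by blast
qed

text \<open>Members may overlap, degenerate to points or be empty, since only upper bounds on their
  number matter. Affineness stays outside the definition, so that one cover can serve all neurons of
  a layer at once.\<close>

definition interval_cover :: "real set set \<Rightarrow> bool" where
  "interval_cover P \<longleftrightarrow> finite P \<and> \<Union>P = UNIV \<and> (\<forall>I\<in>P. is_interval I)"

lemma piecewise_linear_iff_interval_cover:
  "piecewise_linear f \<longleftrightarrow> (\<exists>P. interval_cover P \<and> (\<forall>I\<in>P. affine_fun_on f I))"
  unfolding piecewise_linear_def interval_cover_def by blast

text \<open>Pigeonhole: a maximal piece is infinite and \<open>P\<close> is finite, so some member
  \<open>q M\<close> meets it in infinitely many points. Merging with \<open>q M\<close> cannot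
  enlarge \<open>M\<close>, hence \<open>q M\<close> lies inside \<open>M\<close>. Two pieces with
  the same \<open>q M\<close> then overlap in infinitely many points and merge, so they are
  equal.\<close>

lemma maximal_affine_pieces_le_cover:
  assumes P: "interval_cover P" and aff: "\<And>I. I \<in> P \<Longrightarrow> affine_fun_on f I"
  shows "finite (maximal_affine_pieces f)" "card (maximal_affine_pieces f) \<le> card P"
proof -
  let ?M = "maximal_affine_pieces f"
  have fin: "finite P" and cov: "\<Union>P = UNIV" using P by (auto simp: interval_cover_def)
  have "\<exists>Q. Q \<in> P \<and> infinite (M \<inter> Q)" if "M \<in> ?M" for M
  proof (rule ccontr)
    assume "\<nexists>Q. Q \<in> P \<and> infinite (M \<inter> Q)"
    then have "finite (\<Union>Q\<in>P. M \<inter> Q)" using fin by blast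
    moreover have "(\<Union>Q\<in>P. M \<inter> Q) = M" using cov by blast
    ultimately show False
      using that infinite_if_interior_nonempty by (auto simp: maximal_affine_pieces_def)
  qed
  then obtain q where q: "\<And>M. M \<in> ?M \<Longrightarrow> q M \<in> P \<and> infinite (M \<inter> q M)" by metis
  have sub: "q M \<subseteq> M" if "M \<in> ?M" for M
  proof -
    have M: "is_interval M" "affine_fun_on f M"
      "\<And>J. is_interval J \<Longrightarrow> M \<subseteq> J \<Longrightarrow> affine_fun_on f J \<Longrightarrow> J = M"
      using that by (auto simp: maximal_affine_pieces_def)
    have "is_interval (q M)" "affine_fun_on f (q M)"
      using q[OF that] P aff by (auto simp: interval_cover_def)
    from affine_on_infinite_merge[OF M(1) this(1) M(2) this(2)] q[OF that]
    have "M \<union> q M = M" by (intro M(3)) auto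
    then show ?thesis by blast
  qed
  have inj: "inj_on q ?M"
  proof (rule inj_onI)
    fix M M' assume M: "M \<in> ?M" and M': "M' \<in> ?M" and eq: "q M = q M'"
    have "M \<inter> q M \<subseteq> M \<inter> M'" using sub[OF M'] eq by auto
    then have inf: "infinite (M \<inter> M')" using q[OF M] infinite_super by blast
    have "M \<union> M' = M" "M \<union> M' = M'"
      using affine_on_infinite_merge[OF _ _ _ _ inf] M M'
      unfolding maximal_affine_pieces_def by blast+
    then show "M = M'" by blast
  qed
  have "q ` ?M \<subseteq> P" using q by blast
  then show "finite ?M" "card ?M \<le> card P"
    using inj fin by (auto intro: inj_on_finite card_inj_on_le)
qed

section \<open>The sawtooth\<close>

definition tent :: "real \<Rightarrow> real" where
  "tent x = max 0 (1 - \<bar>2 * x - 1\<bar>)"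

lemma tent_outside: "x \<le> 0 \<or> 1 \<le> x \<Longrightarrow> tent x = 0"
  unfolding tent_def by auto

lemma tent_rising: "0 \<le> x \<Longrightarrow> x \<le> 1 / 2 \<Longrightarrow> tent x = 2 * x"
  unfolding tent_def by (auto simp: abs_if max_def)

lemma tent_falling: "1 / 2 \<le> x \<Longrightarrow> x \<le> 1 \<Longrightarrow> tent x = 2 - 2 * x"
  unfolding tent_def by (auto simp: abs_if max_def)

lemma continuous_on_tent: "continuous_on UNIV tent"
  unfolding tent_def by (intro continuous_intros)

lemma compactly_supported_tent: "compactly_supported tent"
proof -
  have "x \<in> {0..1}" if "tent x \<noteq> 0" for x
    using that by (rule contrapos_np) (auto intro!: tent_outside)
  then have "{x. tent x \<noteq> 0} \<subseteq> {0..1}" by blast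
  then show ?thesis
    unfolding compactly_supported_def
    using bounded_subset[OF bounded_closed_interval] by (simp add: compact_closure)
qed

lemma piecewise_linear_tent: "piecewise_linear tent"
proof -
  let ?P = "{{..0}, {0..1/2}, {1/2..1}, {1..}} :: real set set"
  have "affine_fun_on tent {..0}" "affine_fun_on tent {1..}"
    unfolding affine_fun_on_def using tent_outside
    by (intro exI[of _ 0] exI[of _ 0]; simp)+
  moreover have "affine_fun_on tent {0..1/2}"
    unfolding affine_fun_on_def using tent_rising
    by (intro exI[of _ 2] exI[of _ 0]) simp
  moreover have "affine_fun_on tent {1/2..1}"
    unfolding affine_fun_on_def using tent_falling
    by (intro exI[of _ "-2"] exI[of _ 2]) simp
  moreover have "interval_cover ?P"
    by (auto simp: interval_cover_def is_interval_convex_1)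
  ultimately show ?thesis
    unfolding piecewise_linear_iff_interval_cover by (intro exI[of _ ?P]) auto
qed

section \<open>Piecewise linearity is preserved by cascades\<close>

lemma piecewise_linear_compose_affine:
  assumes "piecewise_linear f"
  shows "piecewise_linear (\<lambda>x. f (c * x + d))"
proof -
  obtain P where P: "interval_cover P" "\<forall>I\<in>P. affine_fun_on f I"
    using assms by (auto simp: piecewise_linear_iff_interval_cover)
  let ?Q = "vimage (\<lambda>x. c * x + d) ` P"
  have "\<Union>?Q = (\<lambda>x. c * x + d) -` \<Union>P" by blast
  then have "interval_cover ?Q"
    using P(1) is_interval_affine_vimage by (auto simp: interval_cover_def)
  then show ?thesis
    unfolding piecewise_linear_iff_interval_cover
    using P(2) affine_fun_on_compose_affine by (intro exI[of _ ?Q]) auto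
qed

lemma piecewise_linear_add:
  assumes "piecewise_linear f" "piecewise_linear h"
  shows "piecewise_linear (\<lambda>x. f x + h x)"
proof -
  obtain P Q where P: "interval_cover P" "\<forall>I\<in>P. affine_fun_on f I"
    and Q: "interval_cover Q" "\<forall>I\<in>Q. affine_fun_on h I"
    using assms by (auto simp: piecewise_linear_iff_interval_cover)
  \<comment> \<open>The common refinement of both covers: each of its members is contained in one
    member of either cover.\<close>
  let ?R = "(\<lambda>(I, J). I \<inter> J) ` (P \<times> Q)"
  have "x \<in> \<Union>?R" for x
  proof -
    obtain I J where "x \<in> I" "I \<in> P" "x \<in> J" "J \<in> Q"
      using P(1) Q(1) unfolding interval_cover_def by (metis UNIV_I UnionE)
    then show ?thesis by blast
  qed
  then have "interval_cover ?R"
    using P(1) Q(1) by (auto simp: interval_cover_def intro: is_interval_Int)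
  moreover have "affine_fun_on (\<lambda>x. f x + h x) I" if "I \<in> ?R" for I
    using that P(2) Q(2) by (auto intro!: affine_fun_on_add intro: affine_fun_on_subset)
  ultimately show ?thesis
    unfolding piecewise_linear_iff_interval_cover by blast
qed

lemma piecewise_linear_cmult:
  "piecewise_linear f \<Longrightarrow> piecewise_linear (\<lambda>x. c * f x)"
  unfolding piecewise_linear_def by (erule ex_forward) (auto intro: affine_fun_on_cmult)

lemma piecewise_linear_mask_operator:
  assumes "piecewise_linear f"
  shows "piecewise_linear (mask_operator m f)"
  unfolding mask_operator_def
  using piecewise_linear_compose_affine[OF assms, of 2 0]
    piecewise_linear_compose_affine[OF assms, of 2 "-1"]
  by (intro piecewise_linear_add piecewise_linear_cmult) simp_all

text \<open>This yields finiteness of the set of maximal pieces; the \<open>card\<close> of an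
  infinite set would be 0, and a lower bound on it would fail.\<close>

lemma piecewise_linear_cascade:
  assumes "piecewise_linear g"
  shows "piecewise_linear (cascade a g n)"
proof -
  have "piecewise_linear (foldr (\<lambda>k. mask_operator (a k)) ks g)" for ks
    using assms by (induction ks) (auto intro: piecewise_linear_mask_operator)
  then show ?thesis by (simp add: cascade_def)
qed

section \<open>Explicit form and piece count of the iterated tent\<close>

abbreviation sawtooth :: "nat \<Rightarrow> real \<Rightarrow> real" where
  "sawtooth \<equiv> cascade (\<lambda>_. (1, 1)) tent"

text \<open>One more operator adds the values at \<open>2 * x\<close> and \<open>2 * x - 1\<close>.
  The shift by 1 becomes a shift by \<open>2 ^ n\<close> at the scale of the tents, so the second
  summand supplies exactly the upper half of the new indices.\<close>

lemma sawtooth_eq_sum: "sawtooth n x = (\<Sum>j<2 ^ n. tent (2 ^ n * x - real j))"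
proof -
  define V where "V = mask_operator (1, 1)"
  \<comment> \<open>The masks do not depend on \<open>k\<close>, so the cascade is an iterate of
    \<open>V\<close>, and the induction can peel off the outermost operator.\<close>
  have "foldr (\<lambda>k. V) ks = V ^^ length ks" for ks :: "nat list"
    by (induction ks) auto
  then have saw: "sawtooth n = (V ^^ n) tent" for n
    by (simp add: cascade_def V_def[symmetric] del: upt_Suc)
  have "(V ^^ n) tent x = (\<Sum>j<2 ^ n. tent (2 ^ n * x - real j))"
  proof (induction n arbitrary: x)
    case 0
    show ?case by simp
  next
    case (Suc n)
    let ?f = "\<lambda>j. tent (2 ^ Suc n * x - real j)"
    have "(V ^^ Suc n) tent x = (V ^^ n) tent (2 * x) + (V ^^ n) tent (2 * x - 1)"
      by (simp add: V_def mask_operator_def)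
    also have "\<dots> = (\<Sum>j<2 ^ n. ?f j) + (\<Sum>j<2 ^ n. ?f (2 ^ n + j))"
      by (simp add: Suc algebra_simps)
    also have "(\<Sum>j<2 ^ n. ?f (2 ^ n + j)) = (\<Sum>j=2^n..<2^n + 2^n. ?f j)"
      using sum.shift_bounds_nat_ivl[of ?f 0 "2^n" "2^n"]
      by (simp add: atLeast0LessThan add.commute)
    also have "(\<Sum>j<2 ^ n. ?f j) + \<dots> = (\<Sum>j<2 ^ n + 2 ^ n. ?f j)"
      using sum.atLeastLessThan_concat[of 0 "2^n" "2^n + 2^n" ?f]
      by (simp add: atLeast0LessThan)
    also have "2 ^ n + 2 ^ n = (2 ^ Suc n :: nat)" by simp
    finally show ?case .
  qed
  then show ?thesis by (simp add: saw)
qed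

text \<open>On the rising flank of tent \<open>i\<close>, every other summand is evaluated outside
  the open unit interval and vanishes. Both end points are included, as the values 0 and 1 there are
  what separates the pieces.\<close>

lemma sawtooth_rising:
  assumes "i < 2 ^ n" "real i \<le> 2 ^ n * x" "2 ^ n * x \<le> real i + 1 / 2"
  shows "sawtooth n x = 2 * (2 ^ n * x - real i)"
proof -
  have "tent (2 ^ n * x - real j) = 0" if "j \<noteq> i" for j
  proof (rule tent_outside)
    have "real i + 1 \<le> real j \<or> real j + 1 \<le> real i" using that by linarith
    then show "2 ^ n * x - real j \<le> 0 \<or> 1 \<le> 2 ^ n * x - real j"
      using assms by linarith
  qed
  then have "sawtooth n x = (\<Sum>j<2 ^ n. if j = i then tent (2 ^ n * x - real i) else 0)"
    unfolding sawtooth_eq_sum by (intro sum.cong) auto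
  also have "\<dots> = tent (2 ^ n * x - real i)" using assms by simp
  finally show ?thesis using assms by (simp add: tent_rising)
qed

text \<open>Counting the rising flanks suffices. An affine piece containing two of them would vanish
  at two distinct feet, hence everywhere, although it reaches 1 at a peak.\<close>

lemma sawtooth_maximal_affine_pieces:
  "finite (maximal_affine_pieces (sawtooth n))"
  "2 ^ n \<le> card (maximal_affine_pieces (sawtooth n))"
proof -
  let ?M = "maximal_affine_pieces (sawtooth n)"
  \<comment> \<open>The left foot and the peak of tent \<open>i\<close>.\<close>
  define l r where "l i = real i / 2 ^ n" and "r i = (real i + 1 / 2) / 2 ^ n" for i
  have l: "2 ^ n * l i = real i" and r: "2 ^ n * r i = real i + 1 / 2" for i
    by (simp_all add: l_def r_def)
  have lr: "l i < r i" for i by (simp add: l_def r_def field_simps)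
  obtain P where "interval_cover P" "\<forall>I\<in>P. affine_fun_on (sawtooth n) I"
    using piecewise_linear_cascade[OF piecewise_linear_tent]
    unfolding piecewise_linear_iff_interval_cover by blast
  then show fin: "finite ?M"
    by (intro maximal_affine_pieces_le_cover(1)) auto
  have "\<exists>M\<in>?M. {l i..r i} \<subseteq> M" if i: "i < 2 ^ n" for i
  proof (rule maximal_affine_piece_exists)
    show "is_interval {l i..r i}" by (rule is_interval_cc)
    show "interior {l i..r i} \<noteq> {}" using lr[of i] by simp
    have "sawtooth n x = (2 * 2 ^ n) * x + (- 2 * real i)" if "x \<in> {l i..r i}" for x
    proof -
      have "real i \<le> 2 ^ n * x" "2 ^ n * x \<le> real i + 1 / 2"
        using that l[of i] r[of i] mult_left_mono[of "l i" x "2 ^ n"] mult_left_mono[of x "r i" "2 ^ n"]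
        by auto
      from sawtooth_rising[OF i this] show ?thesis by (simp add: algebra_simps)
    qed
    then show "affine_fun_on (sawtooth n) {l i..r i}"
      unfolding affine_fun_on_def by blast
  qed
  then obtain p where p: "\<And>i. i < 2 ^ n \<Longrightarrow> p i \<in> ?M \<and> {l i..r i} \<subseteq> p i" by metis
  have "p i \<noteq> p j" if ij: "i < 2 ^ n" "j < 2 ^ n" "i \<noteq> j" for i j
  proof
    assume eq: "p i = p j"
    obtain m b where mb: "\<And>x. x \<in> p i \<Longrightarrow> sawtooth n x = m * x + b"
      using p[OF ij(1)] unfolding maximal_affine_pieces_def affine_fun_on_def by auto
    have "l i \<in> p i" "r i \<in> p i" "l j \<in> p i"
      using p[OF ij(1)] p[OF ij(2)] lr[of i] lr[of j] eq by auto
    moreover have "sawtooth n (l i) = 0" "sawtooth n (r i) = 1" "sawtooth n (l j) = 0"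
      using sawtooth_rising[OF ij(1), of "l i"] sawtooth_rising[OF ij(1), of "r i"]
        sawtooth_rising[OF ij(2), of "l j"] by (simp_all add: l r)
    ultimately have vals: "m * l i + b = 0" "m * r i + b = 1" "m * l j + b = 0"
      using mb by fastforce+
    have "l i \<noteq> l j" using ij(3) by (simp add: l_def)
    then have "m = 0 \<and> b = 0"
      using vals affine_coeffs_unique[of "l i" "l j" m b 0 0] by simp
    then show False using vals by simp
  qed
  then have "inj_on p {..<2 ^ n}" by (auto simp: inj_on_def)
  moreover have "p ` {..<2 ^ n} \<subseteq> ?M" using p by auto
  ultimately show "2 ^ n \<le> card ?M"
    using card_inj_on_le[OF _ _ fin] by fastforce
qed

section \<open>Pieces of ReLU networks\<close>

text \<open>Breakpoints are inserted in increasing order: a new largest \<open>t\<close> truncates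
  all old members to \<open>{..t}\<close> and adds the single member \<open>{t..}\<close>, so the
  count grows by at most one.\<close>

lemma interval_cover_split_at:
  assumes "finite T"
  shows "\<exists>Q. interval_cover Q \<and> card Q \<le> card T + 1 \<and>
    (\<forall>J\<in>Q. \<forall>t\<in>T. J \<subseteq> {..t} \<or> J \<subseteq> {t..})"
  using assms
proof (induction T rule: finite_linorder_max_induct)
  case empty
  show ?case
    by (intro exI[of _ "{UNIV}"]) (auto simp: interval_cover_def)
next
  case (insert t T)
  then obtain Q where Q: "interval_cover Q" "card Q \<le> card T + 1"
    "\<forall>J\<in>Q. \<forall>s\<in>T. J \<subseteq> {..s} \<or> J \<subseteq> {s..}" by blast
  let ?R = "insert {t..} ((\<lambda>J. J \<inter> {..t}) ` Q)"
  have finQ: "finite Q" using Q(1) by (simp add: interval_cover_def)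
  have "x \<in> \<Union>?R" for x
  proof -
    obtain J where "J \<in> Q" "x \<in> J"
      using Q(1) unfolding interval_cover_def by (metis UNIV_I UnionE)
    then show ?thesis by (cases "x \<le> t") auto
  qed
  then have "\<Union>?R = UNIV" by blast
  then have "interval_cover ?R"
    using Q(1) by (auto simp: interval_cover_def is_interval_ic is_interval_ci intro!: is_interval_Int)
  moreover have "card ?R \<le> card (insert t T) + 1"
  proof -
    have "card ?R \<le> Suc (card ((\<lambda>J. J \<inter> {..t}) ` Q))"
      by (rule card_insert_le_m1) auto
    also have "\<dots> \<le> Suc (card Q)" using card_image_le[OF finQ] by simp
    also have "\<dots> \<le> card (insert t T) + 1" using Q(2) insert.hyps by auto
    finally show ?thesis .
  qed
  moreover have "J \<subseteq> {..s} \<or> J \<subseteq> {s..}" if J: "J \<in> ?R" and s: "s \<in> insert t T" for J s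
  proof (cases "J = {t..}")
    \<comment> \<open>The new ray lies to the right of every earlier breakpoint, since
      \<open>t\<close> is the largest.\<close>
    case True
    then show ?thesis using s insert.hyps(2) by force
  next
    case False
    then obtain K where "K \<in> Q" "J = K \<inter> {..t}" using J by blast
    then show ?thesis using s Q(3) by blast
  qed
  ultimately show ?case by blast
qed

text \<open>An affine function has constant sign on either side of its zero \<open>- b / m\<close>,
  and everywhere if \<open>m = 0\<close>; where the sign is constant, the activation is the identity
  or zero.\<close>

lemma affine_fun_on_relu:
  fixes m b :: real
  assumes "m \<noteq> 0 \<Longrightarrow> J \<subseteq> {..- b / m} \<or> J \<subseteq> {- b / m..}"
    and f: "\<forall>x\<in>J. f x = m * x + b"
  shows "affine_fun_on (\<lambda>x. max (f x) 0) J"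
proof -
  have "(\<forall>x\<in>J. 0 \<le> f x) \<or> (\<forall>x\<in>J. f x \<le> 0)"
  proof (cases "m = 0")
    case True
    then show ?thesis using f by (cases "0 \<le> b") auto
  next
    case False
    then consider "m > 0" | "m < 0" by linarith
    then show ?thesis
      using assms(1)[OF False] f
      by cases (auto simp: field_simps subset_iff)
  qed
  then show ?thesis
  proof
    assume "\<forall>x\<in>J. 0 \<le> f x"
    then have "\<forall>x\<in>J. max (f x) 0 = m * x + b" using f by (auto simp: max_def)
    then show ?thesis unfolding affine_fun_on_def by blast
  next
    assume "\<forall>x\<in>J. f x \<le> 0"
    then have "\<forall>x\<in>J. max (f x) 0 = 0 * x + 0" by (auto simp: max_def)
    then show ?thesis unfolding affine_fun_on_def by blast
  qed
qed

text \<open>The \<open>w\<close> affine formulas contribute at most \<open>w\<close> kinks.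
  \<open>Q\<close> covers the whole line, but the formulas hold only on \<open>I\<close>, so
  affineness is claimed on \<open>I \<inter> J\<close>.\<close>

lemma relu_split_interval:
  fixes f :: "nat \<Rightarrow> real \<Rightarrow> real"
  assumes "\<And>k. k < w \<Longrightarrow> affine_fun_on (f k) I"
  shows "\<exists>Q. interval_cover Q \<and> card Q \<le> w + 1 \<and>
    (\<forall>J\<in>Q. \<forall>k<w. affine_fun_on (\<lambda>x. max (f k x) 0) (I \<inter> J))"
proof -
  obtain m b where mb: "\<And>k. k < w \<Longrightarrow> \<forall>x\<in>I. f k x = m k * x + b k"
    using assms unfolding affine_fun_on_def by metis
  \<comment> \<open>For \<open>m k = 0\<close> the quotient is 0 by convention; this extra
    breakpoint is harmless and \<open>card ?T\<close> stays at most \<open>w\<close>.\<close>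
  let ?T = "(\<lambda>k. - b k / m k) ` {..<w}"
  obtain Q where Q: "interval_cover Q" "card Q \<le> card ?T + 1"
    "\<forall>J\<in>Q. \<forall>t\<in>?T. J \<subseteq> {..t} \<or> J \<subseteq> {t..}"
    using interval_cover_split_at[of ?T] by auto
  have "card ?T \<le> w" using card_image_le[of "{..<w}"] by simp
  moreover have "affine_fun_on (\<lambda>x. max (f k x) 0) (I \<inter> J)" if "J \<in> Q" "k < w" for J k
  proof (rule affine_fun_on_relu)
    show "I \<inter> J \<subseteq> {..- b k / m k} \<or> I \<inter> J \<subseteq> {- b k / m k..}"
      using Q(3) that by blast
    show "\<forall>x\<in>I \<inter> J. f k x = m k * x + b k" using mb that by blast
  qed
  ultimately show ?thesis using Q by (intro exI[of _ Q]) auto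
qed

lemma relu_refine_cover:
  fixes f :: "nat \<Rightarrow> real \<Rightarrow> real"
  assumes P: "interval_cover P" and aff: "\<And>I k. I \<in> P \<Longrightarrow> k < w \<Longrightarrow> affine_fun_on (f k) I"
  shows "\<exists>Q. interval_cover Q \<and> card Q \<le> card P * (w + 1) \<and>
    (\<forall>J\<in>Q. \<forall>k<w. affine_fun_on (\<lambda>x. max (f k x) 0) J)"
proof -
  have fin: "finite P" using P by (simp add: interval_cover_def)
  obtain q where q: "\<And>I. I \<in> P \<Longrightarrow> interval_cover (q I)" "\<And>I. I \<in> P \<Longrightarrow> card (q I) \<le> w + 1"
    "\<And>I J k. I \<in> P \<Longrightarrow> J \<in> q I \<Longrightarrow> k < w \<Longrightarrow> affine_fun_on (\<lambda>x. max (f k x) 0) (I \<inter> J)"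
  proof -
    have "\<forall>I\<in>P. \<exists>Q. interval_cover Q \<and> card Q \<le> w + 1 \<and>
        (\<forall>J\<in>Q. \<forall>k<w. affine_fun_on (\<lambda>x. max (f k x) 0) (I \<inter> J))"
      using relu_split_interval aff by blast
    from bchoice[OF this] show ?thesis using that by blast
  qed
  \<comment> \<open>The kinks depend on the interval, so each \<open>I\<close> is cut only by its
    own cover \<open>q I\<close>; this gives \<open>w + 1\<close> parts per interval instead of a
    common refinement of all the \<open>q I\<close>.\<close>
  let ?R = "(\<lambda>(I, J). I \<inter> J) ` Sigma P q"
  have finS: "finite (Sigma P q)" using fin q(1) by (auto simp: interval_cover_def)
  have "x \<in> \<Union>?R" for x
  proof -
    obtain I where I: "I \<in> P" "x \<in> I"
      using P unfolding interval_cover_def by (metis UNIV_I UnionE)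
    obtain J where "J \<in> q I" "x \<in> J"
      using q(1)[OF I(1)] unfolding interval_cover_def by (metis UNIV_I UnionE)
    then show ?thesis using I by blast
  qed
  then have "\<Union>?R = UNIV" by blast
  then have "interval_cover ?R"
    using P q(1) finS by (auto simp: interval_cover_def intro!: is_interval_Int)
  moreover have "card ?R \<le> card P * (w + 1)"
  proof -
    have "card ?R \<le> card (Sigma P q)" by (rule card_image_le[OF finS])
    also have "\<dots> = (\<Sum>I\<in>P. card (q I))"
      using fin q(1) by (auto simp: interval_cover_def)
    also have "\<dots> \<le> (\<Sum>I\<in>P. w + 1)" using q(2) by (intro sum_mono) auto
    finally show ?thesis by simp
  qed
  ultimately show ?thesis using q(3) by (intro exI[of _ ?R]) auto
qed

section \<open>Propagation of affine covers through the layers\<close>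

lemma affine_fun_on_apply_layer:
  assumes "\<And>x. dim_vec (v x) = dim_col A" "dim_vec b = dim_row A" "i < dim_row A"
    and "\<And>k. k < dim_col A \<Longrightarrow> affine_fun_on (\<lambda>x. vec_index (v x) k) I"
  shows "affine_fun_on (\<lambda>x. vec_index (apply_layer (A, b) (v x)) i) I"
proof -
  have "vec_index (apply_layer (A, b) (v x)) i =
      (\<Sum>k<dim_col A. A $$ (i, k) * vec_index (v x) k) + vec_index b i" for x
    using assms(1-3) by (simp add: scalar_prod_def atLeast0LessThan)
  then show ?thesis
    using assms(4) by (auto intro!: affine_fun_on_add affine_fun_on_sum affine_fun_on_cmult
      affine_fun_on_const)
qed

text \<open>Kept as a product over the individual hidden dimensions, because it is later compared
  both with width and depth and with the parameter count.\<close>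

abbreviation pieces_bound :: "affine_layer list \<Rightarrow> nat" where
  "pieces_bound ls \<equiv> (\<Prod>(A, b)\<leftarrow>ls. dim_row A + 1)"

text \<open>Induction on the hidden layers for an arbitrary coordinatewise affine input
  \<open>v\<close> on a cover \<open>P\<close>: the first layer refines \<open>P\<close>, and its
  activated output is the input of the remaining network. The output layer adds no kinks.\<close>

lemma layers_affine_cover:
  assumes "layers_fit d (ls @ [out]) 1" "interval_cover P" "\<And>x. dim_vec (v x) = d"
    and "\<And>I k. I \<in> P \<Longrightarrow> k < d \<Longrightarrow> affine_fun_on (\<lambda>x. vec_index (v x) k) I"
  shows "\<exists>Q. interval_cover Q \<and> card Q \<le> card P * pieces_bound ls \<and>
    (\<forall>J\<in>Q. affine_fun_on (\<lambda>x. vec_index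
      (apply_layer out (fold (\<lambda>l v. relu_vec (apply_layer l v)) ls (v x))) 0) J)"
  using assms
proof (induction ls arbitrary: d P v)
  case Nil
  obtain A b where out: "out = (A, b)" by (cases out)
  have "affine_fun_on (\<lambda>x. vec_index (apply_layer (A, b) (v x)) 0) I" if "I \<in> P" for I
    using Nil that by (intro affine_fun_on_apply_layer) (auto simp: out)
  then show ?case using Nil(2) by (intro exI[of _ P]) (auto simp: out)
next
  case (Cons l ls)
  obtain A b where l: "l = (A, b)" by (cases l)
  have dims: "dim_col A = d" "dim_vec b = dim_row A" and
    fit: "layers_fit (dim_row A) (ls @ [out]) 1"
    using Cons.prems(1) by (auto simp: l)
  let ?u = "\<lambda>x. apply_layer (A, b) (v x)"
  have dimu: "dim_vec (?u x) = dim_row A" for x using dims by simp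
  have "affine_fun_on (\<lambda>x. vec_index (?u x) k) I" if "I \<in> P" "k < dim_row A" for I k
    using Cons.prems(3,4) that dims by (intro affine_fun_on_apply_layer) auto
  then have "\<exists>Q. interval_cover Q \<and> card Q \<le> card P * (dim_row A + 1) \<and>
      (\<forall>J\<in>Q. \<forall>k<dim_row A. affine_fun_on (\<lambda>x. max (vec_index (?u x) k) 0) J)"
    by (rule relu_refine_cover[OF Cons.prems(2), of _ "\<lambda>k x. vec_index (?u x) k"])
  then obtain Q where Q: "interval_cover Q" "card Q \<le> card P * (dim_row A + 1)"
    "\<And>J k. J \<in> Q \<Longrightarrow> k < dim_row A \<Longrightarrow> affine_fun_on (\<lambda>x. max (vec_index (?u x) k) 0) J"
    by blast
  let ?v = "\<lambda>x. relu_vec (?u x)"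
  have "dim_vec (?v x) = dim_row A" for x using dimu by (simp add: relu_vec_def)
  moreover have "affine_fun_on (\<lambda>x. vec_index (?v x) k) J" if "J \<in> Q" "k < dim_row A" for J k
  proof -
    have "vec_index (?v x) k = max (vec_index (?u x) k) 0" for x
      using that(2) dimu unfolding relu_vec_def by (metis index_map_vec(1))
    then show ?thesis using Q(3)[OF that] by simp
  qed
  ultimately obtain R where R: "interval_cover R" "card R \<le> card Q * pieces_bound ls"
    "\<forall>J\<in>R. affine_fun_on (\<lambda>x. vec_index
      (apply_layer out (fold (\<lambda>l v. relu_vec (apply_layer l v)) ls (?v x))) 0) J"
    using Cons.IH[OF fit Q(1), of ?v] by blast
  have "card R \<le> card P * (dim_row A + 1) * pieces_bound ls"
    using R(2) mult_le_mono1[OF Q(2)] le_trans by blast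
  then show ?case using R(1,3) by (intro exI[of _ R]) (auto simp: l algebra_simps)
qed

lemma represents_card_maximal_affine_pieces:
  assumes "represents N f"
  shows "card (maximal_affine_pieces f) \<le> pieces_bound (hidden_layers N)"
proof -
  have fit: "layers_fit 1 (hidden_layers N @ [output_layer N]) 1" and f: "f = net_fun N"
    using assms by (auto simp: represents_def valid_net_def all_layers_def)
  \<comment> \<open>The network input is the identity, affine on the one-member cover
    \<open>{UNIV}\<close>.\<close>
  have "affine_fun_on (\<lambda>x. x) UNIV"
    unfolding affine_fun_on_def by (intro exI[of _ 1] exI[of _ 0]) simp
  then have "\<exists>Q. interval_cover Q \<and> card Q \<le> card {UNIV :: real set} * pieces_bound (hidden_layers N) \<and>
      (\<forall>J\<in>Q. affine_fun_on (\<lambda>x. vec_index (apply_layer (output_layer N)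
        (fold (\<lambda>l v. relu_vec (apply_layer l v)) (hidden_layers N) (vec_of_list [x]))) 0) J)"
    by (intro layers_affine_cover[OF fit]) (auto simp: interval_cover_def)
  then obtain Q where "interval_cover Q" "card Q \<le> pieces_bound (hidden_layers N)"
    "\<forall>J\<in>Q. affine_fun_on f J"
    unfolding f net_fun_def by auto
  then show ?thesis using maximal_affine_pieces_le_cover(2)[of Q f] by fastforce
qed

section \<open>Bounds by width, depth and parameter count\<close>

lemma pieces_bound_le_width_depth:
  "pieces_bound (hidden_layers N) \<le> (net_width N + 1) ^ net_depth N"
proof -
  \<comment> \<open>\<open>W\<close> is a fixed upper bound here, since the width itself would
    change along the list.\<close>
  have "pieces_bound ls \<le> (W + 1) ^ length ls" if "\<forall>(A, b)\<in>set ls. dim_row A \<le> W" for ls W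
    using that by (induction ls) (auto intro!: mult_mono simp del: mult_Suc)
  moreover have "\<forall>(A, b)\<in>set (hidden_layers N). dim_row A \<le> net_width N"
    unfolding net_width_def by (force intro: Max_ge)
  ultimately show ?thesis unfolding net_depth_def by blast
qed

text \<open>Depth alone does not bound the parameters, as a layer from dimension 0 to dimension 0
  has no entries. Comparing with the number of pieces avoids this: such a layer contributes only the
  factor 1.\<close>

lemma pieces_bound_le_params:
  assumes "valid_net N"
  shows "pieces_bound (hidden_layers N) \<le> 2 ^ param_count N"
proof -
  have "pieces_bound ls \<le> 2 ^ (\<Sum>(A, b)\<leftarrow>ls @ [out]. dim_row A * dim_col A + dim_vec b)"
    if "layers_fit d (ls @ [out]) 1" for ls out d
    using that
  proof (induction ls arbitrary: d)
    case Nil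
    show ?case by simp
  next
    case (Cons l ls)
    obtain A b where l: "l = (A, b)" by (cases l)
    have "dim_row A + 1 \<le> 2 ^ dim_row A" by (simp add: Suc_le_eq)
    \<comment> \<open>The bias already has \<open>dim_row A\<close> entries, so the estimate
      survives \<open>dim_col A = 0\<close>.\<close>
    also have "\<dots> \<le> 2 ^ (dim_row A * dim_col A + dim_vec b)"
      using Cons.prems by (intro power_increasing) (auto simp: l)
    finally have "dim_row A + 1 \<le> 2 ^ (dim_row A * dim_col A + dim_vec b)" .
    moreover have "pieces_bound ls \<le> 2 ^ (\<Sum>(A, b)\<leftarrow>ls @ [out]. dim_row A * dim_col A + dim_vec b)"
      using Cons.prems by (intro Cons.IH[of "dim_row A"]) (auto simp: l)
    ultimately have "(dim_row A + 1) * pieces_bound ls \<le> 2 ^ (dim_row A * dim_col A + dim_vec b) *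
      2 ^ (\<Sum>(A, b)\<leftarrow>ls @ [out]. dim_row A * dim_col A + dim_vec b)"
      by (rule mult_le_mono)
    then show ?case by (simp add: l power_add algebra_simps)
  qed
  then show ?thesis
    using assms unfolding valid_net_def param_count_def all_layers_def by blast
qed

lemma ln_le_of_power_le:
  assumes "(2 :: nat) ^ n \<le> w ^ L" "0 < w"
  shows "real n * ln 2 \<le> real L * ln (real w)"
proof -
  have "(2 :: real) ^ n \<le> real w ^ L"
    using assms(1) by (metis of_nat_le_iff of_nat_numeral of_nat_power)
  then have "ln ((2 :: real) ^ n) \<le> ln (real w ^ L)" using assms(2) by (subst ln_le_cancel_iff) auto
  then show ?thesis using assms(2) by (simp add: ln_realpow)
qed

theorem proposition3p2:
  shows "\<exists>(g :: real \<Rightarrow> real) (a :: nat \<Rightarrow> real \<times> real).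
    compactly_supported g \<and> continuous_on UNIV g \<and> piecewise_linear g \<and>
    bounded (a ` {1..}) \<and>
    (\<forall>n\<ge>1. finite (maximal_affine_pieces (cascade a g n)) \<and>
            card (maximal_affine_pieces (cascade a g n)) \<ge> 2 ^ n) \<and>
    (\<forall>n\<ge>1. \<forall>N W L. represents N (cascade a g n) \<and> net_width N = W \<and> net_depth N = L \<longrightarrow>
        (W + 1) ^ L \<ge> 2 ^ n \<and>
        real L \<ge> real n * ln 2 / ln (real W + 1)) \<and>
    (\<forall>W. \<exists>c>0. \<forall>n\<ge>1. \<forall>N. represents N (cascade a g n) \<and> net_width N \<le> W \<longrightarrow>
        real (net_depth N) \<ge> c * real n \<and>
        real (param_count N) \<ge> c * real n)"
proof -
  have pieces: "2 ^ n \<le> pieces_bound (hidden_layers N)" if "represents N (sawtooth n)" for n N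
    using sawtooth_maximal_affine_pieces(2) represents_card_maximal_affine_pieces[OF that]
      le_trans by blast
  have power: "2 ^ n \<le> (net_width N + 1) ^ net_depth N" if "represents N (sawtooth n)" for n N
    using pieces[OF that] pieces_bound_le_width_depth le_trans by blast
  have depth: "real n * ln 2 / ln (real (net_width N) + 1) \<le> real (net_depth N)"
    if "represents N (sawtooth n)" for n N
  proof (cases "net_width N = 0")
    \<comment> \<open>Here the denominator is \<open>ln 1 = 0\<close> and the quotient is 0 by
      convention.\<close>
    case True
    then show ?thesis by simp
  next
    case False
    then have "0 < ln (real (net_width N) + 1)" by simp
    then show ?thesis
      using ln_le_of_power_le[OF power[OF that]] by (simp add: pos_divide_le_eq add.commute)
  qed
  have linear: "\<exists>c>0. \<forall>n\<ge>1. \<forall>N. represents N (sawtooth n) \<and> net_width N \<le> W \<longrightarrow>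
      c * real n \<le> real (net_depth N) \<and> c * real n \<le> real (param_count N)" for W
  proof -
    \<comment> \<open>\<open>W + 2\<close> instead of \<open>W + 1\<close> keeps the logarithm
      positive for \<open>W = 0\<close> and gives \<open>c \<le> 1\<close>. Thus the same
      \<open>c\<close> serves the parameter bound, where even \<open>n\<close> itself is a lower
      bound.\<close>
    define c where "c = ln 2 / ln (real W + 2)"
    have pos: "0 < ln (real W + 2)" by simp
    have c: "0 < c" "c \<le> 1" by (simp_all add: c_def)
    have "c * real n \<le> real (net_depth N)" "c * real n \<le> real (param_count N)"
      if N: "represents N (sawtooth n)" "net_width N \<le> W" for n N
    proof -
      have "2 ^ n \<le> (W + 2) ^ net_depth N"
        using power[OF N(1)] power_mono[of "net_width N + 1" "W + 2" "net_depth N"] N(2) by linarith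
      from ln_le_of_power_le[OF this]
      have "real n * ln 2 \<le> real (net_depth N) * ln (real W + 2)" by (simp add: add.commute)
      then show "c * real n \<le> real (net_depth N)"
        using pos by (simp add: c_def pos_divide_le_eq mult.commute)
      have "valid_net N" using N(1) by (simp add: represents_def)
      then have "(2 :: nat) ^ n \<le> 2 ^ param_count N"
        using pieces[OF N(1)] pieces_bound_le_params le_trans by blast
      then have "real n \<le> real (param_count N)" by simp
      then show "c * real n \<le> real (param_count N)"
        using mult_right_mono[OF c(2), of "real n"] by simp
    qed
    then show ?thesis using c(1) by blast
  qed
  show ?thesis
  proof (intro exI[of _ tent] exI[of _ "\<lambda>_. (1, 1)"] conjI)
    show "bounded ((\<lambda>_ :: nat. (1 :: real, 1 :: real)) ` {1..})"
      by (rule finite_imp_bounded[OF finite_subset[of _ "{(1, 1)}"]]) auto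
    show "compactly_supported tent" by (rule compactly_supported_tent)
    show "continuous_on UNIV tent" by (rule continuous_on_tent)
    show "piecewise_linear tent" by (rule piecewise_linear_tent)
    show "\<forall>n\<ge>1. finite (maximal_affine_pieces (sawtooth n)) \<and>
        2 ^ n \<le> card (maximal_affine_pieces (sawtooth n))"
      using sawtooth_maximal_affine_pieces by blast
    show "\<forall>n\<ge>1. \<forall>N W L. represents N (sawtooth n) \<and> net_width N = W \<and> net_depth N = L \<longrightarrow>
        2 ^ n \<le> (W + 1) ^ L \<and> real n * ln 2 / ln (real W + 1) \<le> real L"
      using power depth by blast
    show "\<forall>W. \<exists>c>0. \<forall>n\<ge>1. \<forall>N. represents N (sawtooth n) \<and> net_width N \<le> W \<longrightarrow>
        c * real n \<le> real (net_depth N) \<and> c * real n \<le> real (param_count N)"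
      using linear by blast
  qed
qed

end
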